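(* Locally Minimal Defensive Alliance on the graphs of minimum degree at least 2 admits a kernel of size $\mathcal{O}({\Delta^{k^{2}+2k}})$, when parameterized by the solution size $k$ and maximum degree $\Delta(G)$.
   Context: Let $G=(V,E)$ be a finite, simple, undirected graph. For $D\subseteq V$ and $v\in V$, let $d_D(v)$ denote the number of neighbours of $v$ in $D$, and $D^c=V\setminus D$. A non-empty set $D\subseteq V$ is a defensive alliance in $G$ if for each $v\in D$, $d_D(v)+1\geq d_{D^c}(v)$. A defensive alliance $D$ is locally minimal if for every $v\in D$, $D\setminus\{v\}$ is not a defensive alliance. The problem Locally Minimal Defensive Alliance is: given a graph $G$ and an integer $k$, does $G$ have a locally minimal defensive alliance $D$ with $|D|\geq k$? $\Delta(G)$ denotes the maximum degree of $G$. *)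

theory Defs
  imports Main "HOL-Computational_Algebra.Polynomial"
begin

section \<open>Defensive alliances\<close>

definition simple_graph :: "'a set \<Rightarrow> 'a set set \<Rightarrow> bool" where
  "simple_graph V E \<longleftrightarrow> finite V \<and> (\<forall>e\<in>E. e \<subseteq> V \<and> card e = 2)"

definition deg_in :: "'a set set \<Rightarrow> 'a set \<Rightarrow> 'a \<Rightarrow> nat" where
  "deg_in E D v = card {u \<in> D. {v, u} \<in> E}"

text \<open>Both degrees are meaningful only for a non-empty finite vertex set.\<close>

definition max_degree :: "'a set \<Rightarrow> 'a set set \<Rightarrow> nat" where
  "max_degree V E = Max (deg_in E V ` V)"

definition min_degree :: "'a set \<Rightarrow> 'a set set \<Rightarrow> nat" where
  "min_degree V E = Min (deg_in E V ` V)"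

definition defensive_alliance :: "'a set \<Rightarrow> 'a set set \<Rightarrow> 'a set \<Rightarrow> bool" where
  "defensive_alliance V E D \<longleftrightarrow>
     D \<noteq> {} \<and> D \<subseteq> V \<and> (\<forall>v\<in>D. deg_in E D v + 1 \<ge> deg_in E (V - D) v)"

definition locally_minimal_defensive_alliance ::
    "'a set \<Rightarrow> 'a set set \<Rightarrow> 'a set \<Rightarrow> bool" where
  "locally_minimal_defensive_alliance V E D \<longleftrightarrow>
     defensive_alliance V E D \<and> (\<forall>v\<in>D. \<not> defensive_alliance V E (D - {v}))"


section \<open>Random access machine programs\<close>

text \<open>
  A state consists of registers and of a memory, all cells holding natural numbers; the memory
  is addressed indirectly through registers. Every instruction and every test costs one step.
  Since the only arithmetic is addition and truncated subtraction, a step lengthens the binary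
  representation of the largest stored number by at most one bit. Hence polynomially many steps
  here amount to polynomial time on a Turing machine.
\<close>

type_synonym ram_state = "(nat \<Rightarrow> nat) \<times> (nat \<Rightarrow> nat)"

datatype com =
    Const nat nat
  | Add nat nat nat
  | Sub nat nat nat
  | Load nat nat
  | Store nat nat
  | Seq com com
  | Cond nat com com
  | While nat com

inductive exec :: "com \<Rightarrow> ram_state \<Rightarrow> nat \<Rightarrow> ram_state \<Rightarrow> bool" where
  Const: "exec (Const r c) (R, M) 1 (R(r := c), M)"
| Add: "exec (Add r a b) (R, M) 1 (R(r := R a + R b), M)"
| Sub: "exec (Sub r a b) (R, M) 1 (R(r := R a - R b), M)"
| Load: "exec (Load r a) (R, M) 1 (R(r := M (R a)), M)"
| Store: "exec (Store a r) (R, M) 1 (R, M(R a := R r))"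
| Seq: "exec p s t s' \<Longrightarrow> exec q s' t' s'' \<Longrightarrow> exec (Seq p q) s (t + t') s''"
| Cond_nonzero: "R r \<noteq> 0 \<Longrightarrow> exec p (R, M) t s' \<Longrightarrow> exec (Cond r p q) (R, M) (t + 1) s'"
| Cond_zero: "R r = 0 \<Longrightarrow> exec q (R, M) t s' \<Longrightarrow> exec (Cond r p q) (R, M) (t + 1) s'"
| While_stop: "R r = 0 \<Longrightarrow> exec (While r p) (R, M) 1 (R, M)"
| While_step: "R r \<noteq> 0 \<Longrightarrow> exec p (R, M) t s' \<Longrightarrow> exec (While r p) s' t' s'' \<Longrightarrow>
    exec (While r p) (R, M) (t + t' + 1) s''"

definition initial_state :: "nat list \<Rightarrow> ram_state" where
  "initial_state xs = ((\<lambda>_. 0), (\<lambda>i. if i < length xs then xs ! i else 0))"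

text \<open>
  The output is read off from the beginning of the memory, whatever follows is ignored;
  encodings must therefore be self-delimiting.
\<close>

definition outputs_within :: "com \<Rightarrow> nat list \<Rightarrow> nat \<Rightarrow> nat list \<Rightarrow> bool" where
  "outputs_within p xs T ys \<longleftrightarrow>
     (\<exists>t R M. exec p (initial_state xs) t (R, M) \<and> t \<le> T \<and> (\<forall>i < length ys. M i = ys ! i))"

definition poly_time_computable ::
    "('i \<Rightarrow> nat list) \<Rightarrow> ('i \<Rightarrow> nat) \<Rightarrow> 'i set \<Rightarrow> ('i \<Rightarrow> 'i) \<Rightarrow> bool" where
  "poly_time_computable enc sz X f \<longleftrightarrow>
     (\<exists>(p :: com) (q :: nat poly). \<forall>x\<in>X. outputs_within p (enc x) (poly q (sz x)) (enc (f x)))"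


section \<open>Kernels\<close>

text \<open>
  \<open>X\<close> is the set of instances, \<open>Y\<close> the predicate singling out the yes-instances, \<open>\<kappa>\<close> the
  parameterization. The constant in the O-bound is uniform in all parameters.
\<close>

definition is_kernelization ::
    "('i \<Rightarrow> nat list) \<Rightarrow> ('i \<Rightarrow> nat) \<Rightarrow> 'i set \<Rightarrow> ('i \<Rightarrow> bool) \<Rightarrow> ('i \<Rightarrow> 'p) \<Rightarrow> ('p \<Rightarrow> nat) \<Rightarrow>
     ('i \<Rightarrow> 'i) \<Rightarrow> bool" where
  "is_kernelization enc sz X Y \<kappa> h f \<longleftrightarrow>
     poly_time_computable enc sz X f \<and>
     (\<forall>x\<in>X. f x \<in> X \<and> (Y (f x) \<longleftrightarrow> Y x) \<and> sz (f x) \<le> h (\<kappa> x))"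

definition admits_kernel_of_size_O ::
    "('i \<Rightarrow> nat list) \<Rightarrow> ('i \<Rightarrow> nat) \<Rightarrow> 'i set \<Rightarrow> ('i \<Rightarrow> bool) \<Rightarrow> ('i \<Rightarrow> 'p) \<Rightarrow> ('p \<Rightarrow> nat) \<Rightarrow>
     bool" where
  "admits_kernel_of_size_O enc sz X Y \<kappa> g \<longleftrightarrow>
     (\<exists>f (C :: nat). is_kernelization enc sz X Y \<kappa> (\<lambda>z. C * g z) f)"


section \<open>The problem Locally Minimal Defensive Alliance\<close>

text \<open>
  An instance \<open>(n, E, k)\<close> stands for the graph with vertex set \<open>{..<n}\<close> and edge set \<open>E\<close>,
  together with the number \<open>k\<close>.
\<close>

type_synonym lmda_inst = "nat \<times> nat set set \<times> nat"

text \<open>The number of vertices, \<open>k\<close>, and the rows of the adjacency matrix.\<close>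

fun lmda_encode :: "lmda_inst \<Rightarrow> nat list" where
  "lmda_encode (n, E, k) =
     n # k # concat (map (\<lambda>i. map (\<lambda>j. if {i, j} \<in> E then 1 else 0) [0..<n]) [0..<n])"

fun lmda_size :: "lmda_inst \<Rightarrow> nat" where
  "lmda_size (n, E, k) = n + card E + k"

fun lmda_yes :: "lmda_inst \<Rightarrow> bool" where
  "lmda_yes (n, E, k) \<longleftrightarrow>
     (\<exists>D. locally_minimal_defensive_alliance {..<n} E D \<and> card D \<ge> k)"

fun lmda_param :: "lmda_inst \<Rightarrow> nat \<times> nat" where
  "lmda_param (n, E, k) = (k, max_degree {..<n} E)"

definition lmda_insts_min_degree :: "nat \<Rightarrow> lmda_inst set" where
  "lmda_insts_min_degree d =
     {(n, E, k). n \<noteq> 0 \<and> simple_graph {..<n} E \<and> min_degree {..<n} E \<ge> d}"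

end

theory Submission
  imports Defs
begin

text \<open>
  If a vertex set \<open>S\<close> is deleted and a vertex \<open>v\<close> outside \<open>S\<close> violates the alliance condition for
  \<open>V - S\<close>, then \<open>v\<close> has more neighbours inside \<open>S\<close> than outside, so moving \<open>v\<close> into \<open>S\<close> lowers the
  number of edges leaving \<open>S\<close>. Hence this peeling stops after few steps, and \<open>V - S\<close> contains a
  defensive alliance as soon as \<open>|S|\<close> plus the number of edges leaving \<open>S\<close> is less than \<open>|V|\<close>. For
  \<open>S\<close> the closed neighbourhood of a locally minimal alliance \<open>D\<close>, an inclusion-minimal alliance in
  \<open>V - S\<close> can be joined to \<open>D\<close>; minimum degree 2 excludes one-element alliances, which keeps the
  union locally minimal. So every graph with more than \<open>(k - 1) (\<Delta> + 1)\<^sup>2\<close> vertices is a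
  yes-instance and is replaced by a triangle, whereas all other graphs are small already.
\<close>

section \<open>Large graphs are yes-instances\<close>

lemma deg_in_mono:
  assumes "finite B" "A \<subseteq> B"
  shows "deg_in E A v \<le> deg_in E B v"
  unfolding deg_in_def using assms by (intro card_mono) auto

text \<open>Lets the alliance condition at \<open>v\<close> pass between a set and its union with a
  set that \<open>v\<close> does not touch.\<close>

lemma deg_in_Un_no_neighbours:
  assumes "\<And>u. u \<in> B \<Longrightarrow> {v, u} \<notin> E"
  shows "deg_in E (A \<union> B) v = deg_in E A v"
    and "deg_in E (C - (A \<union> B)) v = deg_in E (C - A) v"
  unfolding deg_in_def using assms by (auto intro!: arg_cong[where f = card])

lemma deg_in_insert:
  assumes "finite A" "v \<notin> A"
  shows "deg_in E (insert v A) w = deg_in E A w + (if {w, v} \<in> E then 1 else 0)"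
proof -
  have "{u \<in> insert v A. {w, u} \<in> E} =
      (if {w, v} \<in> E then insert v {u \<in> A. {w, u} \<in> E} else {u \<in> A. {w, u} \<in> E})"
    by auto
  then show ?thesis
    using assms by (simp add: deg_in_def)
qed

text \<open>Serves to exchange endpoints in the boundary count and to read degrees off matrix
  rows.\<close>

lemma deg_in_eq_sum:
  assumes "finite A"
  shows "deg_in E A v = (\<Sum>u\<in>A. if {v, u} \<in> E then 1 else 0)"
proof -
  have "(\<Sum>u\<in>A. if {v, u} \<in> E then 1 else 0 :: nat) = (\<Sum>u\<in>{u \<in> A. {v, u} \<in> E}. 1)"
    using assms by (intro sum.inter_filter[symmetric])
  then show ?thesis
    by (simp add: deg_in_def)
qed

text \<open>The number of edges between \<open>S\<close> and \<open>V - S\<close>: each is counted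
  once, at its endpoint in \<open>S\<close>.\<close>

definition edge_boundary :: "'a set \<Rightarrow> 'a set set \<Rightarrow> 'a set \<Rightarrow> nat" where
  "edge_boundary V E S = (\<Sum>w\<in>S. deg_in E (V - S) w)"

text \<open>Edges from \<open>v\<close> to \<open>S\<close> become internal, and only edges from
  \<open>v\<close> to the rest start to leave. The form is additive because subtraction truncates;
  it is an inequality because a loop at \<open>v\<close> would count on the right only.\<close>

lemma edge_boundary_insert:
  assumes "finite V" "S \<subseteq> V" "v \<in> V - S"
  shows "edge_boundary V E (insert v S) + deg_in E S v \<le> edge_boundary V E S + deg_in E (V - S) v"
proof -
  let ?W = "V - insert v S"
  have fin: "finite S" "finite ?W"
    using assms finite_subset by auto
  have "V - S = insert v ?W"
    using assms by auto
  then have ins: "deg_in E (V - S) w = deg_in E ?W w + (if {w, v} \<in> E then 1 else 0)" for w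
    using deg_in_insert[OF fin(2), of v E w] by simp
  have "deg_in E S v = (\<Sum>w\<in>S. if {w, v} \<in> E then 1 else 0)"
    using fin by (simp add: deg_in_eq_sum insert_commute)
  then have "edge_boundary V E S = (\<Sum>w\<in>S. deg_in E ?W w) + deg_in E S v"
    using fin by (simp only: edge_boundary_def ins sum.distrib)
  moreover have "edge_boundary V E (insert v S) = deg_in E ?W v + (\<Sum>w\<in>S. deg_in E ?W w)"
    using fin assms by (simp add: edge_boundary_def)
  moreover have "deg_in E ?W v \<le> deg_in E (V - S) v"
    using assms by (intro deg_in_mono) auto
  ultimately show ?thesis
    by simp
qed

text \<open>A violating vertex has at least two more neighbours in \<open>S\<close> than in
  \<open>V - S\<close>, so absorbing it raises \<open>card S\<close> by 1 and lowers the boundary by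
  at least 2. Hence the strict bound is invariant under peeling.\<close>

lemma defensive_alliance_outside:
  assumes "finite V" "S \<subseteq> V" "card S + edge_boundary V E S < card V"
  shows "\<exists>A \<subseteq> V - S. defensive_alliance V E A"
  using assms
proof (induction "card (V - S)" arbitrary: S rule: less_induct)
  case less
  show ?case
  proof (cases "defensive_alliance V E (V - S)")
    case True
    then show ?thesis by blast
  next
    case False
    have compl: "V - (V - S) = S"
      using less.prems by auto
    \<comment> \<open>The invariant gives \<open>card S < card V\<close>, so a failing
      \<open>V - S\<close> must contain a violating vertex.\<close>
    have "V - S \<noteq> {}"
      using less.prems by auto
    then obtain v where v: "v \<in> V - S" "deg_in E (V - S) v + 1 < deg_in E S v"
      using False unfolding defensive_alliance_def compl by (auto simp: not_le)
    have "edge_boundary V E (insert v S) < edge_boundary V E S"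
      using edge_boundary_insert[OF less.prems(1,2) v(1), of E] v(2) by linarith
    moreover have "card (insert v S) = Suc (card S)"
      using v less.prems finite_subset by (intro card_insert_disjoint) auto
    ultimately have "card (insert v S) + edge_boundary V E (insert v S) < card V"
      using less.prems(3) by linarith
    moreover have "card (V - insert v S) < card (V - S)"
      using v less.prems by (intro psubset_card_mono) auto
    ultimately have "\<exists>A \<subseteq> V - insert v S. defensive_alliance V E A"
      using v less.prems by (intro less.hyps) auto
    then show ?thesis by blast
  qed
qed

section \<open>Local minimality, unions and growth of alliances\<close>

lemma locally_minimal_defensive_alliance_subset:
  assumes "finite V" "defensive_alliance V E A"
  shows "\<exists>D \<subseteq> A. locally_minimal_defensive_alliance V E D"
proof -
  let ?P = "\<lambda>D. D \<subseteq> A \<and> defensive_alliance V E D"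
  obtain D where D: "?P D" and least: "\<And>D'. ?P D' \<Longrightarrow> card D \<le> card D'"
    using exists_least_iff[of "\<lambda>m. \<exists>D. ?P D \<and> card D = m"] assms(2)
    by (metis not_le subset_refl)
  have "\<not> defensive_alliance V E (D - {v})" if "v \<in> D" for v
  proof
    assume "defensive_alliance V E (D - {v})"
    then have "card D \<le> card (D - {v})"
      using D by (intro least) auto
    moreover have "finite D"
      using D assms finite_subset by (auto simp: defensive_alliance_def)
    ultimately show False
      using that card_Diff1_less[of D v] by simp
  qed
  then show ?thesis
    using D by (auto simp: locally_minimal_defensive_alliance_def)
qed

text \<open>\<open>D - {v}\<close> could fail to be an alliance merely by being empty. Minimum
  degree 2 excludes this and leaves a violating vertex, a witness that survives adding vertices far
  from \<open>D\<close>.\<close>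

lemma locally_minimal_defensive_alliance_exposed:
  assumes "finite V" "\<And>u. {u, u} \<notin> E" "\<And>u. u \<in> V \<Longrightarrow> 2 \<le> deg_in E V u"
    and "locally_minimal_defensive_alliance V E D" "v \<in> D"
  obtains u where "u \<in> D - {v}" "deg_in E (D - {v}) u + 1 < deg_in E (V - (D - {v})) u"
proof -
  have D: "defensive_alliance V E D" "\<not> defensive_alliance V E (D - {v})"
    using assms(4,5) by (auto simp: locally_minimal_defensive_alliance_def)
  \<comment> \<open>If \<open>D = {v}\<close>, all neighbours of \<open>v\<close> lie outside
    \<open>D\<close>, and the alliance condition allows at most one.\<close>
  have "D - {v} \<noteq> {}"
  proof
    assume "D - {v} = {}"
    then have D_eq: "D = {v}"
      using assms(5) by auto
    then have "v \<in> V" "deg_in E (V - {v}) v \<le> deg_in E {v} v + 1"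
      using D(1) by (auto simp: defensive_alliance_def)
    moreover have "deg_in E {v} v = 0"
      using assms(2)[of v] by (auto simp: deg_in_def)
    moreover have "deg_in E V v = deg_in E (V - {v}) v"
      unfolding deg_in_def using assms(2)[of v] by (intro arg_cong[where f = card]) auto
    ultimately show False
      using assms(3)[of v] by linarith
  qed
  then show thesis
    using D that unfolding defensive_alliance_def by (meson Diff_subset not_le subset_trans)
qed

text \<open>Vertices of one part see nothing of the other, so both the alliance condition and the
  violation after a deletion carry over from the parts.\<close>

lemma locally_minimal_defensive_alliance_Un:
  assumes "finite V" "\<And>u. {u, u} \<notin> E" "\<And>u. u \<in> V \<Longrightarrow> 2 \<le> deg_in E V u"
    and A: "locally_minimal_defensive_alliance V E A"
    and B: "locally_minimal_defensive_alliance V E B"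
    and disj: "A \<inter> B = {}" and no_edge: "\<And>a b. a \<in> A \<Longrightarrow> b \<in> B \<Longrightarrow> {a, b} \<notin> E"
  shows "locally_minimal_defensive_alliance V E (A \<union> B)"
proof -
  have no_edge': "\<And>a b. a \<in> A \<Longrightarrow> b \<in> B \<Longrightarrow> {b, a} \<notin> E"
    using no_edge by (simp add: insert_commute)
  \<comment> \<open>This and \<open>lm\<close> are stated for arbitrary \<open>P\<close> and
    \<open>Q\<close> to cover both orders of \<open>A\<close> and \<open>B\<close>.\<close>
  have da: "deg_in E (V - (P \<union> Q)) v \<le> deg_in E (P \<union> Q) v + 1"
    if "locally_minimal_defensive_alliance V E P" "\<And>p q. p \<in> P \<Longrightarrow> q \<in> Q \<Longrightarrow> {p, q} \<notin> E" "v \<in> P"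
    for P Q v
    using that deg_in_Un_no_neighbours[where B = Q and v = v and E = E]
    by (auto simp: locally_minimal_defensive_alliance_def defensive_alliance_def)
  have lm: "\<not> defensive_alliance V E ((P \<union> Q) - {v})"
    if P: "locally_minimal_defensive_alliance V E P" and "P \<inter> Q = {}"
      and ne: "\<And>p q. p \<in> P \<Longrightarrow> q \<in> Q \<Longrightarrow> {p, q} \<notin> E" and v: "v \<in> P"
    for P Q v
  proof -
    obtain u where u: "u \<in> P - {v}" "deg_in E (P - {v}) u + 1 < deg_in E (V - (P - {v})) u"
      using locally_minimal_defensive_alliance_exposed[OF assms(1-3) P v] by blast
    have "(P \<union> Q) - {v} = (P - {v}) \<union> Q"
      using that by auto
    then show ?thesis
      using u ne deg_in_Un_no_neighbours[where B = Q and v = u and E = E]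
      by (auto simp: defensive_alliance_def not_le intro!: bexI[of _ u])
  qed
  have BA: "B \<union> A = A \<union> B" "B \<inter> A = {}"
    using disj by auto
  have "deg_in E (V - (A \<union> B)) v \<le> deg_in E (A \<union> B) v + 1" if "v \<in> A \<union> B" for v
    using that da[of A B v] da[of B A v, unfolded BA] A B no_edge no_edge' by blast
  then have "defensive_alliance V E (A \<union> B)"
    using A B by (auto simp: locally_minimal_defensive_alliance_def defensive_alliance_def)
  moreover have "\<not> defensive_alliance V E ((A \<union> B) - {v})" if "v \<in> A \<union> B" for v
    using that lm[of A B v] lm[of B A v, unfolded BA] A B disj no_edge no_edge' by blast
  ultimately show ?thesis
    by (simp add: locally_minimal_defensive_alliance_def)
qed

lemma larger_locally_minimal_defensive_alliance:
  assumes "finite V" "\<And>u. {u, u} \<notin> E" "\<And>u. u \<in> V \<Longrightarrow> 2 \<le> deg_in E V u"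
    and \<Delta>: "\<And>u. u \<in> V \<Longrightarrow> deg_in E V u \<le> \<Delta>"
    and D: "D = {} \<or> locally_minimal_defensive_alliance V E D"
    and large: "card D * (\<Delta> + 1)\<^sup>2 < card V"
  shows "\<exists>D'. locally_minimal_defensive_alliance V E D' \<and> card D < card D'"
proof -
  have "D \<subseteq> V"
    using D by (auto simp: locally_minimal_defensive_alliance_def defensive_alliance_def)
  then have "finite D"
    using assms(1) finite_subset by blast
  \<comment> \<open>A subset of \<open>V\<close> avoiding \<open>S\<close> is disjoint from
    \<open>D\<close> and has no edge to it, as the union lemma requires.\<close>
  define S where "S = (\<Union>v\<in>D. insert v {u \<in> V. {v, u} \<in> E})"
  have "S \<subseteq> V"
    using \<open>D \<subseteq> V\<close> by (auto simp: S_def)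
  have "card S \<le> (\<Sum>v\<in>D. card (insert v {u \<in> V. {v, u} \<in> E}))"
    unfolding S_def by (rule card_UN_le[OF \<open>finite D\<close>])
  also have "\<dots> \<le> (\<Sum>v\<in>D. \<Delta> + 1)"
    using \<Delta> \<open>D \<subseteq> V\<close> assms(1)
    by (intro sum_mono le_trans[OF card_insert_le_m1[of "\<Delta> + 1"]]) (auto simp: deg_in_def)
  finally have card_S: "card S \<le> card D * (\<Delta> + 1)"
    by simp
  have "deg_in E (V - S) w \<le> \<Delta>" if "w \<in> S" for w
    using that \<Delta>[of w] \<open>S \<subseteq> V\<close> deg_in_mono[of V "V - S" E w] assms(1) by auto
  then have "edge_boundary V E S \<le> (\<Sum>w\<in>S. \<Delta>)"
    unfolding edge_boundary_def by (intro sum_mono)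
  then have "card S + edge_boundary V E S \<le> card S * (\<Delta> + 1)"
    by simp
  also have "\<dots> \<le> card D * (\<Delta> + 1)\<^sup>2"
    using mult_right_mono[OF card_S, of "\<Delta> + 1"] by (simp only: power2_eq_square mult.assoc)
  finally have "card S + edge_boundary V E S < card V"
    using large by linarith
  then obtain A where "A \<subseteq> V - S" "defensive_alliance V E A"
    using defensive_alliance_outside[OF assms(1) \<open>S \<subseteq> V\<close>] by auto
  then obtain B where B: "B \<subseteq> V - S" "locally_minimal_defensive_alliance V E B"
    using locally_minimal_defensive_alliance_subset[OF assms(1), of E A] by auto
  have "finite B" "B \<noteq> {}"
    using B assms(1) finite_subset[of B V]
    by (auto simp: locally_minimal_defensive_alliance_def defensive_alliance_def)
  moreover have "D \<inter> B = {}"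
    using B(1) by (auto simp: S_def)
  ultimately have "card D < card (D \<union> B)"
    using \<open>finite D\<close> by (simp add: card_Un_disjoint card_gt_0_iff)
  moreover have "locally_minimal_defensive_alliance V E (D \<union> B)"
    using D
  proof
    assume "D = {}"
    then show ?thesis using B by simp
  next
    assume "locally_minimal_defensive_alliance V E D"
    then show ?thesis
      using assms(1-3) B \<open>D \<inter> B = {}\<close>
      by (intro locally_minimal_defensive_alliance_Un) (auto simp: S_def)
  qed
  ultimately show ?thesis by blast
qed

lemma large_locally_minimal_defensive_alliance:
  assumes "finite V" "\<And>u. {u, u} \<notin> E" "\<And>u. u \<in> V \<Longrightarrow> 2 \<le> deg_in E V u"
    and "\<And>u. u \<in> V \<Longrightarrow> deg_in E V u \<le> \<Delta>"
    and "(k - 1) * (\<Delta> + 1)\<^sup>2 < card V"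
  shows "\<exists>D. locally_minimal_defensive_alliance V E D \<and> k \<le> card D"
  using assms(5)
proof (induction k)
  \<comment> \<open>By truncated subtraction the hypothesis only says that \<open>V\<close> is
    non-empty.\<close>
  case 0
  then show ?case
    using larger_locally_minimal_defensive_alliance[OF assms(1-4), of "{}"] by auto
next
  case (Suc k)
  have "(k - 1) * (\<Delta> + 1)\<^sup>2 \<le> k * (\<Delta> + 1)\<^sup>2"
    by (intro mult_right_mono) auto
  also have "\<dots> < card V"
    using Suc.prems by simp
  finally obtain D where D: "locally_minimal_defensive_alliance V E D" "k \<le> card D"
    using Suc.IH by blast
  show ?case
  \<comment> \<open>Only size exactly \<open>k\<close> calls for an enlargement, and the hypothesis
    for \<open>Suc k\<close> is its threshold.\<close>
  proof (cases "card D = k")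
    case True
    then show ?thesis
      using larger_locally_minimal_defensive_alliance[OF assms(1-4), of D] D Suc.prems
      by (auto simp: Suc_le_eq)
  next
    case False
    then show ?thesis
      using D by (intro exI[of _ D]) auto
  qed
qed


section \<open>The kernelization map\<close>

lemma lmda_instD:
  assumes "(n, E, k) \<in> lmda_insts_min_degree 2"
  shows "n \<noteq> 0" "simple_graph {..<n} E" "{u, u} \<notin> E"
    and "v < n \<Longrightarrow> 2 \<le> deg_in E {..<n} v"
    and "v < n \<Longrightarrow> deg_in E {..<n} v \<le> max_degree {..<n} E"
    and "2 \<le> max_degree {..<n} E" "max_degree {..<n} E \<le> n"
proof -
  show n: "n \<noteq> 0" and sg: "simple_graph {..<n} E"
    using assms by (auto simp: lmda_insts_min_degree_def)
  show "{u, u} \<notin> E"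
    using sg by (force simp: simple_graph_def)
  have lower: "2 \<le> deg_in E {..<n} v" if "v < n" for v
  proof -
    have "min_degree {..<n} E \<le> deg_in E {..<n} v"
      unfolding min_degree_def using that by (intro Min_le) auto
    then show ?thesis
      using assms by (auto simp: lmda_insts_min_degree_def)
  qed
  then show "v < n \<Longrightarrow> 2 \<le> deg_in E {..<n} v" .
  have upper: "deg_in E {..<n} v \<le> max_degree {..<n} E" if "v < n" for v
    unfolding max_degree_def using that by (intro Max_ge) auto
  then show "v < n \<Longrightarrow> deg_in E {..<n} v \<le> max_degree {..<n} E" .
  \<comment> \<open>Needed to absorb the factor \<open>k\<close> into a power of the maximum
    degree.\<close>
  show "2 \<le> max_degree {..<n} E"
    using lower[of 0] upper[of 0] n by simp
  have "deg_in E {..<n} v \<le> n" for v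
    using card_mono[of "{..<n}" "{u \<in> {..<n}. {v, u} \<in> E}"] by (auto simp: deg_in_def)
  then show "max_degree {..<n} E \<le> n"
    unfolding max_degree_def using n by (subst Max_le_iff) auto
qed

lemma lmda_yes_if_large:
  assumes "(n, E, k) \<in> lmda_insts_min_degree 2" "(k - 1) * (max_degree {..<n} E + 1)\<^sup>2 < n"
  shows "lmda_yes (n, E, k)"
  unfolding lmda_yes.simps
  by (rule large_locally_minimal_defensive_alliance[where \<Delta> = "max_degree {..<n} E"])
    (use assms(2) lmda_instD[OF assms(1)] in simp_all)

text \<open>Every edge is listed at its endpoints, each of which lists at most
  \<open>\<Delta>\<close> edges.\<close>

lemma card_edges_le:
  assumes "simple_graph {..<n} E" "\<And>v. v < n \<Longrightarrow> deg_in E {..<n} v \<le> \<Delta>"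
  shows "card E \<le> n * \<Delta>"
proof -
  let ?F = "\<lambda>v. (\<lambda>u. {v, u}) ` {u \<in> {..<n}. {v, u} \<in> E}"
  have "E \<subseteq> (\<Union>v<n. ?F v)"
  proof
    fix e assume e: "e \<in> E"
    then obtain x y where "e = {x, y}" "x < n" "y < n"
      using assms(1) by (fastforce simp: simple_graph_def card_2_iff)
    then show "e \<in> (\<Union>v<n. ?F v)"
      using e by auto
  qed
  then have "card E \<le> card (\<Union>v<n. ?F v)"
    by (intro card_mono) auto
  also have "\<dots> \<le> (\<Sum>v<n. card (?F v))"
    by (intro card_UN_le) auto
  also have "\<dots> \<le> (\<Sum>v<n. \<Delta>)"
    using assms(2) by (intro sum_mono le_trans[OF card_image_le]) (auto simp: deg_in_def)
  finally show ?thesis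
    by simp
qed

text \<open>Vertices and edges contribute at most \<open>8 * (k * \<Delta> ^ 3)\<close>, and
  \<open>k\<close> itself one more such term. Then \<open>k \<le> 2 ^ k \<le> \<Delta> ^ k\<close>
  turns this into a pure power of \<open>\<Delta>\<close>.\<close>

lemma lmda_size_le_if_small:
  assumes inst: "(n, E, k) \<in> lmda_insts_min_degree 2"
    and small: "n \<le> (k - 1) * (max_degree {..<n} E + 1)\<^sup>2"
  shows "lmda_size (n, E, k) \<le> 9 * max_degree {..<n} E ^ (k\<^sup>2 + 2 * k)"
proof -
  define \<Delta> where "\<Delta> = max_degree {..<n} E"
  note I = lmda_instD[OF inst, folded \<Delta>_def]
  \<comment> \<open>For \<open>k \<le> 1\<close> the threshold is 0, contradicting
    \<open>n \<noteq> 0\<close>. The final exponent estimate would fail at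
    \<open>k = 1\<close>.\<close>
  have "k \<ge> 2"
    using small I(1) by (cases "k \<le> 1") auto
  \<comment> \<open>Uses \<open>k - 1 \<le> k\<close> and
    \<open>\<Delta> + 1 \<le> 2 * \<Delta>\<close>.\<close>
  have "n \<le> k * (2 * \<Delta>)\<^sup>2"
    using small I(6) unfolding \<Delta>_def[symmetric]
    by (elim order_trans) (intro mult_mono power_mono; simp)
  moreover have "card E \<le> n * \<Delta>"
    using I by (intro card_edges_le)
  ultimately have "n + card E \<le> k * (2 * \<Delta>)\<^sup>2 * (1 + \<Delta>)"
    using mult_right_mono[of n "k * (2 * \<Delta>)\<^sup>2" "1 + \<Delta>"] by simp
  also have "\<dots> \<le> k * (2 * \<Delta>)\<^sup>2 * (2 * \<Delta>)"
    using I(6) by (intro mult_left_mono) auto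
  also have "\<dots> = 8 * (k * \<Delta> ^ 3)"
    by (simp add: power2_eq_square power3_eq_cube)
  finally have "lmda_size (n, E, k) \<le> 8 * (k * \<Delta> ^ 3) + k * 1"
    by simp
  also have "\<dots> \<le> 8 * (k * \<Delta> ^ 3) + k * \<Delta> ^ 3"
    using I(6) by (intro add_left_mono mult_left_mono) auto
  also have "\<dots> = 9 * (k * \<Delta> ^ 3)"
    by simp
  also have "k * \<Delta> ^ 3 \<le> \<Delta> ^ k * \<Delta> ^ 3"
  proof (intro mult_right_mono)
    have "k \<le> 2 ^ k"
      by (simp add: less_imp_le)
    also have "\<dots> \<le> \<Delta> ^ k"
      using I(6) by (intro power_mono) auto
    finally show "k \<le> \<Delta> ^ k" .
  qed simp
  also have "\<dots> = \<Delta> ^ (k + 3)"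
    by (simp add: power_add)
  also have "\<dots> \<le> \<Delta> ^ (k\<^sup>2 + 2 * k)"
  proof (intro power_increasing)
    have "2 * 2 \<le> k\<^sup>2"
      using \<open>k \<ge> 2\<close> unfolding power2_eq_square by (intro mult_mono) auto
    then show "k + 3 \<le> k\<^sup>2 + 2 * k"
      by linarith
  qed (use I(6) in simp)
  finally show ?thesis
    by (simp add: \<Delta>_def)
qed

text \<open>A fixed yes-instance of minimum degree 2. With \<open>k = 0\<close> its threshold is 0,
  so the criterion for large graphs applies to it.\<close>

definition triangle_inst :: lmda_inst where
  "triangle_inst = (3, {{0, 1}, {0, 2}, {1, 2}}, 0)"

lemma triangle_inst: "triangle_inst \<in> lmda_insts_min_degree 2"
proof -
  let ?E = "{{0, 1}, {0, 2}, {1, 2}} :: nat set set"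
  have V: "{..<3} = {0, 1, 2 :: nat}"
    by auto
  have "{u \<in> {0, 1, 2}. {v, u} \<in> ?E} = {0, 1, 2} - {v}" if "v \<in> {0, 1, 2}" for v :: nat
    using that by (auto simp: doubleton_eq_iff)
  then have "deg_in ?E {..<3} v = 2" if "v \<in> {..<3}" for v
    using that unfolding deg_in_def V by auto
  then have "deg_in ?E {..<3} ` {..<3} = {2}"
    unfolding V by auto
  then have "min_degree {..<3} ?E = 2"
    by (simp add: min_degree_def)
  moreover have "simple_graph {..<3} ?E"
    by (auto simp: simple_graph_def)
  ultimately show ?thesis
    by (simp add: triangle_inst_def lmda_insts_min_degree_def)
qed

lemma lmda_yes_triangle_inst: "lmda_yes triangle_inst"
  using triangle_inst unfolding triangle_inst_def by (rule lmda_yes_if_large) simp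

lemma lmda_size_triangle_inst: "lmda_size triangle_inst \<le> 9"
  using card_length[of "[{0, 1}, {0, 2}, {1, 2}] :: nat set list"]
  unfolding triangle_inst_def lmda_size.simps list.set list.size by linarith

lemma lmda_encode_triangle_inst: "lmda_encode triangle_inst = [3, 0, 0, 1, 1, 1, 0, 1, 1, 1, 0]"
proof -
  have "[0..<3] = [0, 1, 2]"
    by (simp add: numeral_3_eq_3 numeral_2_eq_2)
  then show ?thesis
    by (simp add: triangle_inst_def doubleton_eq_iff)
qed

fun lmda_kernel :: "lmda_inst \<Rightarrow> lmda_inst" where
  "lmda_kernel (n, E, k) =
     (if (k - 1) * (max_degree {..<n} E + 1)\<^sup>2 < n then triangle_inst else (n, E, k))"


section \<open>Running time of random access machine programs\<close>

text \<open>Total correctness with a time budget; nesting it in its own postcondition verifies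
  programs from front to back.\<close>

definition runs :: "com \<Rightarrow> ram_state \<Rightarrow> nat \<Rightarrow> (ram_state \<Rightarrow> bool) \<Rightarrow> bool" where
  "runs p s T Q \<longleftrightarrow> (\<exists>t s'. exec p s t s' \<and> t \<le> T \<and> Q s')"

lemma runs_mono:
  assumes "runs p s T Q" "T \<le> T'" "\<And>s'. Q s' \<Longrightarrow> Q' s'"
  shows "runs p s T' Q'"
proof -
  obtain t s' where "exec p s t s'" "t \<le> T" "Q s'"
    using assms(1) by (auto simp: runs_def)
  then show ?thesis
    unfolding runs_def using assms(2,3) by (intro exI[of _ t] exI[of _ s']) auto
qed

lemma runs_basic:
  "Q (R(r := c), M) \<Longrightarrow> runs (Const r c) (R, M) 1 Q"
  "Q (R(r := R a + R b), M) \<Longrightarrow> runs (Add r a b) (R, M) 1 Q"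
  "Q (R(r := R a - R b), M) \<Longrightarrow> runs (Sub r a b) (R, M) 1 Q"
  "Q (R(r := M (R a)), M) \<Longrightarrow> runs (Load r a) (R, M) 1 Q"
  "Q (R, M(R a := R r)) \<Longrightarrow> runs (Store a r) (R, M) 1 Q"
  unfolding runs_def by (intro exI conjI, rule exec.intros, simp_all)+

lemma runs_Seq:
  assumes "runs p s T (\<lambda>s'. runs q s' T' Q)"
  shows "runs (Seq p q) s (T + T') Q"
proof -
  obtain t s' t' s'' where "exec p s t s'" "t \<le> T" "exec q s' t' s''" "t' \<le> T'" "Q s''"
    using assms by (auto simp: runs_def)
  then have "exec (Seq p q) s (t + t') s''" "t + t' \<le> T + T'" "Q s''"
    by (auto intro: exec.Seq)
  then show ?thesis
    unfolding runs_def by (intro exI conjI)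
qed

lemma runs_Cond:
  assumes "R r \<noteq> 0 \<Longrightarrow> runs p (R, M) T Q" "R r = 0 \<Longrightarrow> runs q (R, M) T Q"
  shows "runs (Cond r p q) (R, M) (T + 1) Q"
proof (cases "R r = 0")
  case True
  then obtain t s' where "exec q (R, M) t s'" "t \<le> T" "Q s'"
    using assms(2) by (auto simp: runs_def)
  then show ?thesis
    unfolding runs_def using exec.Cond_zero[of R r, OF True]
    by (intro exI[of _ "t + 1"] exI[of _ s']) auto
next
  case False
  then obtain t s' where "exec p (R, M) t s'" "t \<le> T" "Q s'"
    using assms(1) by (auto simp: runs_def)
  then show ?thesis
    unfolding runs_def using exec.Cond_nonzero[of R r, OF False]
    by (intro exI[of _ "t + 1"] exI[of _ s']) auto
qed

text \<open>The invariant is indexed by the number of iterations left, which yields termination and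
  the count together. Each iteration pays one test, and the final failing test adds 1.\<close>

lemma runs_While:
  assumes "I m s"
    and "\<And>s. I 0 s \<Longrightarrow> fst s r = 0"
    and "\<And>i s. i < m \<Longrightarrow> I (Suc i) s \<Longrightarrow> fst s r \<noteq> 0 \<and> runs p s T (I i)"
  shows "runs (While r p) s (m * (T + 1) + 1) (I 0)"
  using assms(1,3)
proof (induction m arbitrary: s)
  case 0
  obtain R M where s: "s = (R, M)" by (cases s)
  then have "exec (While r p) s 1 s"
    using 0 assms(2)[of s] exec.While_stop[of R r p M] by simp
  then show ?case
    using 0 unfolding runs_def by (intro exI[of _ 1] exI[of _ s]) simp
next
  case (Suc m)
  obtain R M where s: "s = (R, M)" by (cases s)
  obtain t s' where t: "R r \<noteq> 0" "exec p (R, M) t s'" "t \<le> T" "I m s'"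
    using Suc.prems(2)[of m s] Suc.prems(1) s by (auto simp: runs_def)
  have "runs (While r p) s' (m * (T + 1) + 1) (I 0)"
    using t(4) Suc.prems(2) by (intro Suc.IH) (blast intro: less_SucI)+
  then obtain t' s'' where t': "exec (While r p) s' t' s''" "t' \<le> m * (T + 1) + 1" "I 0 s''"
    by (auto simp: runs_def)
  have "exec (While r p) s (t + t' + 1) s''"
    unfolding s by (rule exec.While_step[where R = R]) (use t t' in auto)
  then show ?case
    using t t' unfolding runs_def
    by (intro exI[of _ "t + t' + 1"] exI[of _ s''] conjI) auto
qed

lemma outputs_within_if_runs:
  assumes "runs p (initial_state xs) T (\<lambda>s. \<forall>i < length ys. snd s i = ys ! i)"
  shows "outputs_within p xs T ys"
  using assms unfolding runs_def outputs_within_def by (metis prod.collapse)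


section \<open>A program for the kernelization map\<close>

text \<open>\<open>Const 0 0\<close> serves as the empty program.\<close>

fun store_list :: "nat \<Rightarrow> nat list \<Rightarrow> com" where
  "store_list i [] = Const 0 0"
| "store_list i (x # xs) =
     Seq (Const 0 i) (Seq (Const 1 x) (Seq (Store 0 1) (store_list (Suc i) xs)))"

text \<open>The clause on cells below \<open>i\<close> carries the induction: the tail must not
  disturb the cell just written.\<close>

lemma runs_store_list:
  "runs (store_list i xs) (R, M) (3 * length xs + 1)
     (\<lambda>s. (\<forall>j<i. snd s j = M j) \<and> (\<forall>j<length xs. snd s (i + j) = xs ! j))"
proof (induction xs arbitrary: i R M)
  case Nil
  have "runs (Const 0 0) (R, M) 1 (\<lambda>s. \<forall>j<i. snd s j = M j)"
    by (intro runs_basic) simp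
  then show ?case
    by simp
next
  case (Cons x xs)
  have "runs (store_list i (x # xs)) (R, M) (1 + (1 + (1 + (3 * length xs + 1))))
     (\<lambda>s. (\<forall>j<i. snd s j = M j) \<and> (\<forall>j<length (x # xs). snd s (i + j) = (x # xs) ! j))"
    (is "runs _ _ _ ?Q")
    unfolding store_list.simps
  proof (intro runs_Seq runs_basic, rule runs_mono[OF Cons.IH order_refl])
    let ?R = "R(0 := i, 1 := x)"
    fix s :: ram_state assume s: "(\<forall>j<Suc i. snd s j = (M(?R 0 := ?R 1)) j) \<and>
      (\<forall>j<length xs. snd s (Suc i + j) = xs ! j)"
    have "snd s (i + j) = (x # xs) ! j" if "j < length (x # xs)" for j
      using s that by (cases j) simp_all
    moreover have "\<forall>j<i. snd s j = M j"
      using s by simp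
    ultimately show "?Q s"
      by blast
  qed
  then show ?case
    by (rule runs_mono) auto
qed

text \<open>
  Registers 0 and 1 hold the constants 0 and 1, registers 2 and 3 hold \<open>n\<close> and \<open>k\<close>, register 4
  points to the next matrix entry, and register 6 holds the maximum of the row sums seen so far.
\<close>

definition row_sum_prog :: com where
  "row_sum_prog = While 7 (Seq (Load 9 4) (Seq (Add 8 8 9) (Seq (Add 4 4 1) (Sub 7 7 1))))"

text \<open>Register 7 counts the columns left, register 8 accumulates, register 9 is scratch. The
  pointer ends at the next row.\<close>

lemma runs_row_sum_prog:
  assumes "R 1 = 1" "R 7 = m"
  shows "runs row_sum_prog (R, M) (m * 5 + 1)
    (\<lambda>s. snd s = M \<and> fst s 8 = R 8 + (\<Sum>c<m. M (R 4 + c)) \<and> fst s 4 = R 4 + m \<and>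
      (\<forall>r. r \<notin> {4, 7, 8, 9} \<longrightarrow> fst s r = R r))"
proof -
  define I where "I i s \<longleftrightarrow> snd s = M \<and> fst s 7 = i \<and> fst s 8 = R 8 + (\<Sum>c<m - i. M (R 4 + c)) \<and>
      fst s 4 = R 4 + (m - i) \<and> (\<forall>r. r \<notin> {4, 7, 8, 9} \<longrightarrow> fst s r = R r)" for i s
  \<comment> \<open>The time is left as a nested sum to match \<open>runs_Seq\<close> and
    \<open>runs_basic\<close> syntactically.\<close>
  have "runs row_sum_prog (R, M) (m * (1 + (1 + (1 + 1)) + 1) + 1) (I 0)"
    unfolding row_sum_prog_def
  proof (rule runs_While)
    show "I m (R, M)"
      using assms by (simp add: I_def)
  next
    fix i s assume i: "i < m" and s: "I (Suc i) s"
    obtain R' where R': "s = (R', M)"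
      using s by (cases s) (simp add: I_def)
    have step: "m - i = Suc (m - Suc i)"
      using i by simp
    have "runs (Seq (Load 9 4) (Seq (Add 8 8 9) (Seq (Add 4 4 1) (Sub 7 7 1)))) (R', M)
        (1 + (1 + (1 + 1))) (I i)"
      using s assms unfolding I_def R' step by (intro runs_Seq runs_basic) simp
    then show "fst s 7 \<noteq> 0 \<and>
        runs (Seq (Load 9 4) (Seq (Add 8 8 9) (Seq (Add 4 4 1) (Sub 7 7 1)))) s (1 + (1 + (1 + 1))) (I i)"
      using s R' by (simp add: I_def)
  qed (simp add: I_def)
  then show ?thesis
    by (rule runs_mono) (simp_all add: I_def)
qed

text \<open>Register 5 counts the rows left. Truncated subtraction gives the maximum, as
  \<open>b + (a - b) = max a b\<close>.\<close>

definition max_row_sum_prog :: com where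
  "max_row_sum_prog = While 5 (Seq (Const 8 0) (Seq (Add 7 2 0) (Seq row_sum_prog
     (Seq (Sub 9 8 6) (Seq (Add 6 6 9) (Sub 5 5 1))))))"

text \<open>\<open>insert 0\<close> reflects the initial value of register 6 and makes the maximum
  meaningful before any row is read.\<close>

lemma runs_max_row_sum_prog:
  assumes "R 0 = 0" "R 1 = 1" "R 2 = n" "R 5 = m" "R 6 = 0"
  shows "runs max_row_sum_prog (R, M) (m * (5 * n + 7) + 1)
    (\<lambda>s. snd s = M \<and> fst s 6 = Max (insert 0 ((\<lambda>i. \<Sum>j<n. M (R 4 + i * n + j)) ` {..<m})) \<and>
      (\<forall>r<4. fst s r = R r))"
proof -
  define a where "a i = (\<Sum>j<n. M (R 4 + i * n + j))" for i
  define I where "I i s \<longleftrightarrow> snd s = M \<and> fst s 5 = i \<and> fst s 6 = Max (insert 0 (a ` {..<m - i})) \<and>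
      fst s 4 = R 4 + (m - i) * n \<and> (\<forall>r<4. fst s r = R r)" for i s
  let ?body = "Seq (Const 8 0) (Seq (Add 7 2 0) (Seq row_sum_prog
     (Seq (Sub 9 8 6) (Seq (Add 6 6 9) (Sub 5 5 1)))))"
  let ?T = "1 + (1 + ((n * 5 + 1) + (1 + (1 + 1))))"
  have "runs max_row_sum_prog (R, M) (m * (?T + 1) + 1) (I 0)"
    unfolding max_row_sum_prog_def
  proof (rule runs_While)
    show "I m (R, M)"
      using assms by (simp add: I_def)
  next
    fix i s assume i: "i < m" and s: "I (Suc i) s"
    obtain R' where R': "s = (R', M)"
      using s by (cases s) (simp add: I_def)
    \<comment> \<open>The number of rows already processed, hence the index of the current
      row.\<close>
    define q where "q = m - Suc i"
    have step: "m - i = Suc q" "m - Suc i = q"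
      using i by (simp_all add: q_def)
    have R'_eq: "R' 0 = 0" "R' 1 = 1" "R' 2 = n" "R' 5 = Suc i" "R' 4 = R 4 + q * n"
      "R' 6 = Max (insert 0 (a ` {..<q}))" "\<forall>r<4. R' r = R r"
      using s assms by (simp_all add: I_def R' step)
    have "Max (insert 0 (a ` {..<Suc q})) = max (a q) (Max (insert 0 (a ` {..<q})))"
      by (simp add: lessThan_Suc insert_commute[of 0])
    then have Max_step: "R' 6 + (a q - R' 6) = Max (insert 0 (a ` {..<Suc q}))"
      using R'_eq by simp
    have "runs ?body (R', M) ?T (I i)"
    proof (intro runs_Seq runs_basic, rule runs_mono[OF runs_row_sum_prog[where m = n] order_refl])
      let ?R = "R'(8 := 0, 7 := (R'(8 := 0)) 2 + (R'(8 := 0)) 0)"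
      fix s' assume s': "snd s' = M \<and> fst s' 8 = ?R 8 + (\<Sum>c<n. M (?R 4 + c)) \<and> fst s' 4 = ?R 4 + n \<and>
        (\<forall>r. r \<notin> {4, 7, 8, 9} \<longrightarrow> fst s' r = ?R r)"
      obtain R'' where R'': "s' = (R'', M)" "R'' 8 = a q" "R'' 4 = R 4 + Suc q * n"
        "R'' 6 = R' 6" "R'' 5 = Suc i" "R'' 1 = 1" "\<forall>r<4. R'' r = R r"
        using s' R'_eq by (cases s') (simp add: a_def)
      show "runs (Seq (Sub 9 8 6) (Seq (Add 6 6 9) (Sub 5 5 1))) s' (1 + (1 + 1)) (I i)"
        unfolding R''(1)
        by (intro runs_Seq runs_basic) (use Max_step R'' in \<open>simp add: I_def step\<close>)
    qed (use R'_eq in simp_all)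
    then show "fst s 5 \<noteq> 0 \<and> runs ?body s ?T (I i)"
      using s R' by (simp add: I_def)
  qed (simp add: I_def)
  then show ?thesis
    by (rule runs_mono) (simp_all add: I_def a_def algebra_simps)
qed

text \<open>Repeated addition, looping over register 6. So the second multiplication in
  \<open>threshold_prog\<close> stays linear in that register although register 3 then holds a
  product.\<close>

definition mult_prog :: com where
  "mult_prog = Seq (Const 8 0) (Seq (Add 7 6 0) (While 7 (Seq (Add 8 8 3) (Sub 7 7 1))))"

lemma runs_mult_prog:
  assumes "R 0 = 0" "R 1 = 1"
  shows "runs mult_prog (R, M) (3 * R 6 + 3)
    (\<lambda>s. snd s = M \<and> fst s 8 = R 3 * R 6 \<and> (\<forall>r<7. fst s r = R r))"
proof -
  define I where "I i s \<longleftrightarrow> snd s = M \<and> fst s 7 = i \<and> fst s 8 = R 3 * (R 6 - i) \<and>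
      (\<forall>r<7. fst s r = R r)" for i s
  let ?body = "Seq (Add 8 8 3) (Sub 7 7 1)"
  have "runs (While 7 ?body) (R(8 := 0, 7 := R 6), M) (R 6 * ((1 + 1) + 1) + 1) (I 0)"
  proof (rule runs_While)
    show "I (R 6) (R(8 := 0, 7 := R 6), M)"
      by (simp add: I_def)
  next
    fix i s assume i: "i < R 6" and s: "I (Suc i) s"
    obtain R' where R': "s = (R', M)"
      using s by (cases s) (simp add: I_def)
    have step: "R 6 - i = Suc (R 6 - Suc i)"
      using i by simp
    have "runs ?body (R', M) (1 + 1) (I i)"
      using s assms unfolding I_def R' step by (intro runs_Seq runs_basic) simp
    then show "fst s 7 \<noteq> 0 \<and> runs ?body s (1 + 1) (I i)"
      using s R' by (simp add: I_def)
  qed (simp add: I_def)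
  then have "runs mult_prog (R, M) (1 + (1 + (R 6 * ((1 + 1) + 1) + 1))) (I 0)"
    unfolding mult_prog_def using assms by (intro runs_Seq runs_basic) simp
  then show ?thesis
    by (rule runs_mono) (simp_all add: I_def)
qed

text \<open>Register 9 ends up non-zero exactly when the threshold lies below \<open>n\<close>.
  Otherwise the memory, and with it the input, is left as the output.\<close>

definition threshold_prog :: com where
  "threshold_prog = Seq (Add 6 6 1) (Seq (Sub 3 3 1) (Seq mult_prog (Seq (Add 3 8 0) (Seq mult_prog
     (Seq (Sub 9 2 8) (Cond 9 (store_list 0 (lmda_encode triangle_inst)) (Const 0 0)))))))"

lemma runs_threshold_prog:
  assumes "R 0 = 0" "R 1 = 1"
  shows "runs threshold_prog (R, M) (6 * R 6 + 51)
    (\<lambda>s. if (R 3 - 1) * (R 6 + 1)\<^sup>2 < R 2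
      then \<forall>i<length (lmda_encode triangle_inst). snd s i = lmda_encode triangle_inst ! i
      else snd s = M)" (is "runs _ _ _ ?Q")
proof -
  let ?T = "3 * (R 6 + 1) + 3"
  \<comment> \<open>34 is \<open>3 * 11 + 1\<close>, the cost of storing the 11 numbers that encode
    the triangle.\<close>
  have "runs threshold_prog (R, M) (1 + (1 + (?T + (1 + (?T + (1 + (34 + 1))))))) ?Q"
    unfolding threshold_prog_def
  proof (intro runs_Seq runs_basic, rule runs_mono[OF runs_mult_prog])
    let ?R = "R(6 := R 6 + R 1, 3 := (R(6 := R 6 + R 1)) 3 - (R(6 := R 6 + R 1)) 1)"
    fix s1 assume s1: "snd s1 = M \<and> fst s1 8 = ?R 3 * ?R 6 \<and> (\<forall>r<7. fst s1 r = ?R r)"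
    obtain R1 where R1: "s1 = (R1, M)" "R1 8 = (R 3 - 1) * (R 6 + 1)" "R1 0 = 0" "R1 1 = 1"
      "R1 2 = R 2" "R1 6 = R 6 + 1"
      using s1 assms by (cases s1) simp
    show "runs (Seq (Add 3 8 0) (Seq mult_prog
       (Seq (Sub 9 2 8) (Cond 9 (store_list 0 (lmda_encode triangle_inst)) (Const 0 0))))) s1
       (1 + (?T + (1 + (34 + 1)))) ?Q"
      unfolding R1(1)
    proof (intro runs_Seq runs_basic, rule runs_mono[OF runs_mult_prog])
      let ?R1 = "R1(3 := R1 8 + R1 0)"
      fix s2 assume s2: "snd s2 = M \<and> fst s2 8 = ?R1 3 * ?R1 6 \<and> (\<forall>r<7. fst s2 r = ?R1 r)"
      obtain R2 where R2: "s2 = (R2, M)" "R2 8 = (R 3 - 1) * (R 6 + 1)\<^sup>2" "R2 2 = R 2"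
        using s2 R1 by (cases s2) (simp add: power2_eq_square mult.assoc del: mult_Suc mult_Suc_right)
      show "runs (Seq (Sub 9 2 8) (Cond 9 (store_list 0 (lmda_encode triangle_inst)) (Const 0 0))) s2
         (1 + (34 + 1)) ?Q"
        unfolding R2(1)
      proof (intro runs_Seq runs_basic runs_Cond)
        assume "(R2(9 := R2 2 - R2 8)) 9 \<noteq> 0"
        then have "(R 3 - 1) * (R 6 + 1)\<^sup>2 < R 2"
          by (simp add: R2)
        then show "runs (store_list 0 (lmda_encode triangle_inst)) (R2(9 := R2 2 - R2 8), M) 34 ?Q"
          by (intro runs_mono[OF runs_store_list]) (simp_all add: lmda_encode_triangle_inst)
      next
        assume "(R2(9 := R2 2 - R2 8)) 9 = 0"
        then have "\<not> (R 3 - 1) * (R 6 + 1)\<^sup>2 < R 2"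
          by (simp add: R2)
        then show "runs (Const 0 0) (R2(9 := R2 2 - R2 8), M) 34 ?Q"
          by (intro runs_mono[OF runs_basic(1)[where Q = "\<lambda>s. snd s = M"]]) simp_all
      qed
    qed (use R1 in simp_all)
  qed (use assms in simp_all)
  then show ?thesis
    by (rule runs_mono) simp_all
qed

text \<open>Registers start at 0, so \<open>Load 2 0\<close> reads cell 0 and, after
  \<open>Const 1 1\<close>, \<open>Load 3 1\<close> reads cell 1. The matrix begins at cell
  2.\<close>

definition kernel_prog :: com where
  "kernel_prog = Seq (Const 1 1) (Seq (Load 2 0) (Seq (Load 3 1) (Seq (Const 4 2) (Seq (Add 5 2 0)
     (Seq max_row_sum_prog threshold_prog)))))"

lemma runs_kernel_prog:
  fixes M :: "nat \<Rightarrow> nat"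
  defines "\<Delta> \<equiv> Max (insert 0 ((\<lambda>i. \<Sum>j<M 0. M (2 + i * M 0 + j)) ` {..<M 0}))"
  shows "runs kernel_prog ((\<lambda>_. 0), M) (M 0 * (5 * M 0 + 7) + 6 * \<Delta> + 57)
    (\<lambda>s. if (M 1 - 1) * (\<Delta> + 1)\<^sup>2 < M 0
      then \<forall>i<length (lmda_encode triangle_inst). snd s i = lmda_encode triangle_inst ! i
      else snd s = M)" (is "runs _ _ _ ?Q")
proof -
  define R :: "nat \<Rightarrow> nat" where "R = (\<lambda>_. 0)(1 := 1, 2 := M 0, 3 := M 1, 4 := 2, 5 := M 0)"
  have "runs max_row_sum_prog (R, M) (M 0 * (5 * M 0 + 7) + 1)
      (\<lambda>s. runs threshold_prog s (6 * \<Delta> + 51) ?Q)"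
  proof (rule runs_mono[OF runs_max_row_sum_prog[where n = "M 0"]])
    fix s assume s: "snd s = M \<and>
      fst s 6 = Max (insert 0 ((\<lambda>i. \<Sum>j<M 0. M (R 4 + i * M 0 + j)) ` {..<M 0})) \<and>
      (\<forall>r<4. fst s r = R r)"
    obtain R' where R': "s = (R', M)" "R' 6 = \<Delta>" "R' 0 = 0" "R' 1 = 1" "R' 2 = M 0" "R' 3 = M 1"
      using s by (cases s) (simp add: R_def \<Delta>_def)
    show "runs threshold_prog s (6 * \<Delta> + 51) ?Q"
      using runs_threshold_prog[of R' M] R' by simp
  qed (simp_all add: R_def)
  then have "runs kernel_prog ((\<lambda>_. 0), M)
      (1 + (1 + (1 + (1 + (1 + ((M 0 * (5 * M 0 + 7) + 1) + (6 * \<Delta> + 51))))))) ?Q"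
    unfolding kernel_prog_def by (intro runs_Seq runs_basic) (simp add: R_def)
  then show ?thesis
    by (rule runs_mono) simp_all
qed

section \<open>Row-major layout of the matrix and the polynomial time bound\<close>

lemma nth_concat_map_upt:
  assumes "\<And>i. length (f i) = n" "i < m" "j < n"
  shows "concat (map f [0..<m]) ! (i * n + j) = f i ! j"
  using assms(2)
proof (induction m)
  case (Suc m)
  have len: "length (concat (map f [0..<m])) = m * n"
    by (induction m) (simp_all add: assms(1))
  show ?case
  proof (cases "i = m")
    case True
    then show ?thesis
      using assms(3) by (simp add: nth_append len)
  next
    case False
    then have "i < m"
      using Suc.prems by simp
    then have "i * n + j < Suc i * n" "Suc i * n \<le> m * n"
      using assms(3) by (simp_all only: mult_le_mono1 Suc_leI) simp
    then show ?thesis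
      using Suc.IH \<open>i < m\<close> by (simp add: nth_append len)
  qed
qed simp

lemma poly_time_computable_lmda_kernel:
  "poly_time_computable lmda_encode lmda_size (lmda_insts_min_degree 2) lmda_kernel"
  unfolding poly_time_computable_def
proof (intro exI ballI)
  fix x assume "x \<in> lmda_insts_min_degree 2"
  moreover obtain n E k where x: "x = (n, E, k)"
    by (cases x)
  ultimately have inst: "(n, E, k) \<in> lmda_insts_min_degree 2"
    by simp
  let ?xs = "lmda_encode (n, E, k)"
  define M where "M = snd (initial_state ?xs)"
  have M: "initial_state ?xs = ((\<lambda>_. 0), M)" "M 0 = n" "M 1 = k"
    and M_out: "\<And>i. i < length ?xs \<Longrightarrow> M i = ?xs ! i"
    by (auto simp: M_def initial_state_def)
  have entry: "M (2 + i * n + j) = (if {i, j} \<in> E then 1 else 0)" if "i < n" "j < n" for i j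
  proof -
    define row where "row i = map (\<lambda>j. if {i, j} \<in> E then 1 else 0 :: nat) [0..<n]" for i
    have xs: "?xs = n # k # concat (map row [0..<n])"
      unfolding row_def[abs_def] by (rule lmda_encode.simps)
    have "i * n + j < Suc i * n" "Suc i * n \<le> n * n"
      using that by (simp_all only: mult_le_mono1 Suc_leI) simp
    then have "i * n + j < n * n"
      by linarith
    moreover have "length (concat (map row [0..<n])) = n * n"
      by (simp add: length_concat comp_def row_def sum_list_triv)
    ultimately have "2 + i * n + j < length ?xs"
      unfolding xs by simp
    then have "M (2 + i * n + j) = concat (map row [0..<n]) ! (i * n + j)"
      unfolding M_out[OF \<open>2 + i * n + j < length ?xs\<close>] unfolding xs by (simp add: numeral_2_eq_2)
    also have "\<dots> = row i ! j"
      using that by (intro nth_concat_map_upt) (simp_all add: row_def)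
    finally show ?thesis
      using that by (simp add: row_def)
  qed
  define \<Delta> where "\<Delta> = max_degree {..<n} E"
  have "(\<Sum>j<n. M (2 + i * n + j)) = deg_in E {..<n} i" if "i < n" for i
    using that entry by (simp add: deg_in_eq_sum)
  then have "(\<lambda>i. \<Sum>j<n. M (2 + i * n + j)) ` {..<n} = deg_in E {..<n} ` {..<n}"
    by (intro image_cong) auto
  \<comment> \<open>The extra 0 is harmless: degrees are natural numbers and there is at least one
    vertex.\<close>
  moreover have "Max (insert 0 (deg_in E {..<n} ` {..<n})) = \<Delta>"
    using lmda_instD(1)[OF inst] by (simp add: \<Delta>_def max_degree_def lessThan_empty_iff)
  ultimately have \<Delta>_eq: "Max (insert 0 ((\<lambda>i. \<Sum>j<n. M (2 + i * n + j)) ` {..<n})) = \<Delta>"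
    by simp
  \<comment> \<open>As \<open>n\<close> and \<open>\<Delta>\<close> are at most the size,
    \<open>n * (5 * n + 7) + 6 * \<Delta> + 57\<close> yields the coefficients 5,
    \<open>7 + 6 = 13\<close> and 57.\<close>
  have "runs kernel_prog (initial_state ?xs) (poly [:57, 13, 5:] (lmda_size (n, E, k)))
     (\<lambda>s. \<forall>i<length (lmda_encode (lmda_kernel (n, E, k))).
        snd s i = lmda_encode (lmda_kernel (n, E, k)) ! i)"
    unfolding M(1)
  proof (rule runs_mono[OF runs_kernel_prog[of M, unfolded M(2,3) \<Delta>_eq]])
    have "n \<le> lmda_size (n, E, k)" "\<Delta> \<le> lmda_size (n, E, k)"
      using lmda_instD(7)[OF inst] by (simp_all add: \<Delta>_def)
    moreover from this have "n * n \<le> lmda_size (n, E, k) * lmda_size (n, E, k)"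
      by (intro mult_mono) auto
    ultimately show "n * (5 * n + 7) + 6 * \<Delta> + 57 \<le> poly [:57, 13, 5:] (lmda_size (n, E, k))"
      by (simp add: algebra_simps del: lmda_size.simps)
  next
    fix s :: ram_state assume "if (k - 1) * (\<Delta> + 1)\<^sup>2 < n
      then \<forall>i<length (lmda_encode triangle_inst). snd s i = lmda_encode triangle_inst ! i
      else snd s = M"
    then show "\<forall>i<length (lmda_encode (lmda_kernel (n, E, k))).
        snd s i = lmda_encode (lmda_kernel (n, E, k)) ! i"
      using M_out by (simp add: \<Delta>_def[symmetric] del: lmda_encode.simps split: if_splits)
  qed
  then show "outputs_within kernel_prog (lmda_encode x) (poly [:57, 13, 5:] (lmda_size x))
      (lmda_encode (lmda_kernel x))"
    unfolding x by (rule outputs_within_if_runs)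
qed

theorem theorem2:
  "admits_kernel_of_size_O lmda_encode lmda_size (lmda_insts_min_degree 2) lmda_yes lmda_param
     (\<lambda>(k, \<Delta>). \<Delta> ^ (k\<^sup>2 + 2 * k))"
  unfolding admits_kernel_of_size_O_def is_kernelization_def
proof (intro exI conjI ballI)
  show "poly_time_computable lmda_encode lmda_size (lmda_insts_min_degree 2) lmda_kernel"
    by (rule poly_time_computable_lmda_kernel)
next
  fix x assume x: "x \<in> lmda_insts_min_degree 2"
  obtain n E k where x_eq: "x = (n, E, k)"
    by (cases x)
  have inst: "(n, E, k) \<in> lmda_insts_min_degree 2"
    using x x_eq by simp
  let ?large = "(k - 1) * (max_degree {..<n} E + 1)\<^sup>2 < n"
  show "lmda_kernel x \<in> lmda_insts_min_degree 2"
    using inst triangle_inst by (simp add: x_eq)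
  show "lmda_yes (lmda_kernel x) \<longleftrightarrow> lmda_yes x"
    using lmda_yes_if_large[OF inst] lmda_yes_triangle_inst
    by (simp add: x_eq del: lmda_yes.simps)
  \<comment> \<open>This goal fixes the constant of the O-bound as 9, for the triangle and the kept
    instances alike.\<close>
  show "lmda_size (lmda_kernel x) \<le> 9 * (case lmda_param x of (k, \<Delta>) \<Rightarrow> \<Delta> ^ (k\<^sup>2 + 2 * k))"
  proof (cases ?large)
    case True
    \<comment> \<open>The bound refers to the parameters of the original instance, so it must be at
      least 1 to cover the triangle.\<close>
    have "1 \<le> max_degree {..<n} E ^ (k\<^sup>2 + 2 * k)"
      using lmda_instD(6)[OF inst] by simp
    then show ?thesis
      using True lmda_size_triangle_inst by (simp add: x_eq)
  next
    case False
    then show ?thesis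
      using lmda_size_le_if_small[OF inst] by (simp add: x_eq not_less del: lmda_size.simps)
  qed
qed

end
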